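(* Let $\upsilon\ge1$ be an integer, $q>-1$ and $p$ real, $s\ge0$ an integer with $s<\frac{p-1}{2}$, let $t,y$ be real numbers, $w>b$ real, and let $\tau\in\mathbb C$ with $\operatorname{Re}(\tau)\ge0$ and $q+1>\operatorname{Re}(\tau)$. Then $${}_wD_{b^+}^{\tau}\left((w-b)^q\;{}_KN_{s;\upsilon}^{(p,q)}\big(t,y(w-b)\big)\right)=(w-b)^{q-\tau}\;{}_KN_{s;\upsilon}^{(p,q-\tau)}\big(t,y(w-b)\big).$$
   Context: $(a)_n$ is the Pochhammer symbol. The first set of finite bivariate biorthogonal N-Konhauser polynomials is $${}_KN_{s;\upsilon}^{(p,q)}(t,w)=\Gamma(p-s)\sum_{k=0}^{s}\sum_{m=0}^{s-k}\frac{(-s)_{k+m}\,t^{s-k}w^{\upsilon m}}{\Gamma(p-2s+k)\,\Gamma(q+1+\upsilon m)\,k!\,m!},$$ the same formula being used when the second parameter is complex. For $\operatorname{Re}(\kappa)>0$ and $w>b$ the Riemann–Liouville fractional integral is ${}_w\mathbb I_{b^+}^{\kappa}(f)(w)=\frac1{\Gamma(\kappa)}\int_b^w(w-\xi)^{\kappa-1}f(\xi)\,d\xi$, and the Riemann–Liouville fractional derivative of order $\kappa$, $\operatorname{Re}(\kappa)\ge0$, is ${}_wD_{b^+}^{\kappa}(f)=\left(\frac{d}{dw}\right)^{n}{}_w\mathbb I_{b^+}^{n-\kappa}(f)$, where $n=[\operatorname{Re}(\kappa)]+1$ and $[\cdot]$ is the integer part. *)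

theory Defs
  imports "HOL-Analysis.Analysis"
begin

text \<open>
  The first set of finite bivariate biorthogonal N-Konhauser polynomials. The second parameter
  is complex; a real parameter \<open>q\<close> is passed as \<open>complex_of_real q\<close>.
\<close>

definition KN :: "nat \<Rightarrow> nat \<Rightarrow> real \<Rightarrow> complex \<Rightarrow> real \<Rightarrow> real \<Rightarrow> complex" where
  "KN s \<upsilon> p q t w =
     complex_of_real (Gamma (p - real s)) *
     (\<Sum>k = 0..s. \<Sum>m = 0..s - k.
        pochhammer (- of_nat s) (k + m) * complex_of_real (t ^ (s - k) * w ^ (\<upsilon> * m)) /
        (complex_of_real (Gamma (p - 2 * real s + real k)) *
         Gamma (q + 1 + of_nat (\<upsilon> * m)) * fact k * fact m))"

definition rl_integrand :: "complex \<Rightarrow> (real \<Rightarrow> complex) \<Rightarrow> real \<Rightarrow> real \<Rightarrow> complex" where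
  "rl_integrand \<kappa> f w \<xi> = complex_of_real (w - \<xi>) powr (\<kappa> - 1) * f \<xi>"

definition rl_integral :: "complex \<Rightarrow> real \<Rightarrow> (real \<Rightarrow> complex) \<Rightarrow> real \<Rightarrow> complex" where
  "rl_integral \<kappa> b f w = 1 / Gamma \<kappa> * integral {b..w} (rl_integrand \<kappa> f w)"

text \<open>The \<open>n\<close>-th derivative of a complex-valued function of a real variable.\<close>

definition nth_vderiv :: "nat \<Rightarrow> (real \<Rightarrow> complex) \<Rightarrow> real \<Rightarrow> complex" where
  "nth_vderiv n = (\<lambda>g x. vector_derivative g (at x)) ^^ n"

definition rl_order :: "complex \<Rightarrow> nat" where
  "rl_order \<kappa> = nat \<lfloor>Re \<kappa>\<rfloor> + 1"

definition rl_deriv :: "complex \<Rightarrow> real \<Rightarrow> (real \<Rightarrow> complex) \<Rightarrow> real \<Rightarrow> complex" where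
  "rl_deriv \<kappa> b f = nth_vderiv (rl_order \<kappa>) (rl_integral (of_nat (rl_order \<kappa>) - \<kappa>) b f)"

text \<open>
  Since \<open>integral\<close> and \<open>vector_derivative\<close> are total functions, \<open>rl_deriv\<close> has a value even where
  the fractional derivative does not exist. The following predicate says that it does exist on all
  of \<open>{b<..}\<close>: the integrals defining the fractional integral converge absolutely, and the
  fractional integral can be differentiated \<open>rl_order \<kappa>\<close> times.
\<close>

definition rl_deriv_exists :: "complex \<Rightarrow> real \<Rightarrow> (real \<Rightarrow> complex) \<Rightarrow> bool" where
  "rl_deriv_exists \<kappa> b f \<longleftrightarrow>
     (\<forall>x>b. rl_integrand (of_nat (rl_order \<kappa>) - \<kappa>) f x absolutely_integrable_on {b..x} \<and>
       (\<forall>k<rl_order \<kappa>.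
          nth_vderiv k (rl_integral (of_nat (rl_order \<kappa>) - \<kappa>) b f) differentiable (at x)))"

end

theory Submission
  imports Defs
begin

text \<open>
  The weight \<open>(x - b)\<^sup>q\<close> turns the polynomial into a finite linear combination of the normalised powers
  \<open>(x - b)\<^sup>a / \<Gamma>(a + 1)\<close> with \<open>a = q + \<upsilon> m\<close>: the factor \<open>1 / \<Gamma>(q + 1 + \<upsilon> m)\<close> of the polynomial is
  exactly the normalisation, and no other factor depends on \<open>q\<close>. On normalised powers fractional
  calculus acts by shifting the exponent: integration of order \<open>\<kappa>\<close> takes \<open>a\<close> to \<open>a + \<kappa>\<close> (lemma
  \<open>has_bochner_integral_conv_normalised_power\<close>), and one ordinary derivative takes \<open>a\<close> to \<open>a - 1\<close>
  (lemma \<open>has_vector_derivative_normalised_power\<close>). So the derivative of order \<open>\<tau>\<close> takes \<open>a\<close> to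
  \<open>a - \<tau>\<close> with the same coefficients, which is the same expansion read for \<open>q - \<tau>\<close>.

  The only analytic input is the rule for the integral, which amounts to the value of Euler's Beta
  integral for complex parameters. This value follows from the observation that
  the functions \<open>e\<^sup>-\<^sup>t t\<^sup>z\<^sup>-\<^sup>1\<close> on the positive half line have total mass \<open>\<Gamma>(z)\<close>, that the total mass of
  a convolution is the product of the masses, and that by homogeneity the convolution of two of these
  functions is a multiple of a third one, the factor being the Beta integral.
\<close>

section \<open>The Beta integral with complex parameters\<close>

text \<open>
  The cut-off at 0 lets all integrals below range over the whole line, where translation, scaling
  and Fubini apply without bookkeeping of domains.
\<close>

definition pos_power :: "complex \<Rightarrow> real \<Rightarrow> complex" where
  "pos_power z t = (if t > 0 then complex_of_real t powr (z - 1) else 0)"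

definition gamma_density :: "complex \<Rightarrow> real \<Rightarrow> complex" where
  "gamma_density z t = complex_of_real (exp (- t)) * pos_power z t"

lemma borel_measurable_pos_power [measurable]: "pos_power z \<in> borel_measurable borel"
proof -
  have "continuous_on {0<..} (\<lambda>t. complex_of_real t powr (z - 1))"
    by (intro continuous_intros) auto
  hence "(\<lambda>t. indicator {0<..} t *\<^sub>R complex_of_real t powr (z - 1)) \<in> borel_measurable borel"
    by (intro borel_measurable_continuous_on_indicator) auto
  also have "(\<lambda>t. indicator {0<..} t *\<^sub>R complex_of_real t powr (z - 1)) = pos_power z"
    by (auto simp: fun_eq_iff pos_power_def indicator_def)
  finally show ?thesis .
qed

lemma borel_measurable_gamma_density [measurable]: "gamma_density z \<in> borel_measurable borel"
  unfolding gamma_density_def by measurable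

lemma pos_power_mult:
  assumes "u > 0"
  shows "pos_power z (u * t) = complex_of_real u powr (z - 1) * pos_power z t"
  using assms by (simp add: pos_power_def zero_less_mult_iff powr_times_real)

lemma Gamma_nonzero_of_Re_pos:
  fixes z :: complex
  assumes "Re z > 0"
  shows "Gamma z \<noteq> 0"
  using assms by (auto simp: Gamma_eq_zero_iff elim!: nonpos_Ints_cases)

lemma has_bochner_integral_gamma_density:
  assumes "Re z > 0"
  shows "has_bochner_integral lborel (gamma_density z) (Gamma z)"
proof -
  let ?g = "\<lambda>t. complex_of_real t powr (z - 1) / complex_of_real (exp t)"
  have eq: "gamma_density z = (\<lambda>t. indicator {0<..} t *\<^sub>R ?g t)"
    by (auto simp: fun_eq_iff gamma_density_def pos_power_def indicator_def exp_minus field_simps)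
  have abs: "set_integrable lebesgue {0<..} ?g"
    using absolutely_integrable_Gamma_integral'[OF assms] .
  have "integrable lborel (gamma_density z)"
    using abs integrable_completion[of "gamma_density z" lborel]
    by (simp add: set_integrable_def eq[symmetric])
  moreover have "integral\<^sup>L lborel (gamma_density z) = Gamma z"
  proof -
    have "integral\<^sup>L lborel (gamma_density z) = integral\<^sup>L lebesgue (gamma_density z)"
      by (rule integral_completion[symmetric]) simp
    also have "\<dots> = integral {0<..} ?g"
      using set_lebesgue_integral_eq_integral(2)[OF abs]
      by (simp add: set_lebesgue_integral_def eq)
    also have "\<dots> = Gamma z"
      using Gamma_integral_complex'[OF assms] by (rule integral_unique)
    finally show ?thesis .
  qed
  ultimately show ?thesis
    by (simp add: has_bochner_integral_iff)
qed

lemma integrable_pos_power_conv: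
  assumes "Re z > 0" "Re a > 0"
  shows "integrable lborel (\<lambda>t. pos_power z (1 - t) * pos_power a t)"
proof (rule Bochner_Integration.integrable_bound)
  show "integrable lborel
      (\<lambda>t. indicator {0..1} t *\<^sub>R (t powr (Re a - 1) * (1 - t) powr (Re z - 1)))"
    using integrable_Beta[OF assms(2,1)] by (simp add: set_integrable_def)
  show "AE t in lborel. norm (pos_power z (1 - t) * pos_power a t) \<le>
      norm (indicator {0..1} t *\<^sub>R (t powr (Re a - 1) * (1 - t) powr (Re z - 1)))"
    by (auto simp: pos_power_def indicator_def norm_mult norm_powr_real_powr mult_ac
             simp del: of_real_diff)
qed measurable

text \<open>
  By homogeneity the convolution of \<open>t\<^sup>z\<^sup>-\<^sup>1\<close> and \<open>t\<^sup>a\<^sup>-\<^sup>1\<close> is determined by its value at 1.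
\<close>

lemma has_bochner_integral_pos_power_conv_scaled:
  assumes "Re z > 0" "Re a > 0" "u > 0"
  shows "has_bochner_integral lborel (\<lambda>t. pos_power z (u - t) * pos_power a t)
           (pos_power (z + a) u * (LBINT t. pos_power z (1 - t) * pos_power a t))"
proof -
  let ?B = "LBINT t. pos_power z (1 - t) * pos_power a t"
  let ?c = "complex_of_real u powr (z - 1) * complex_of_real u powr (a - 1)"
  have "has_bochner_integral lborel (\<lambda>t. pos_power z (1 - t) * pos_power a t) ?B"
    using integrable_pos_power_conv[OF assms(1,2)] by (simp add: has_bochner_integral_iff)
  hence "has_bochner_integral lborel (\<lambda>t. ?c * (pos_power z (1 - t) * pos_power a t)) (?c * ?B)"
    by (intro has_bochner_integral_mult_right) auto
  also have "(\<lambda>t. ?c * (pos_power z (1 - t) * pos_power a t)) =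
      (\<lambda>t. pos_power z (u - (0 + u * t)) * pos_power a (0 + u * t))"
  proof
    fix t
    have "u - (0 + u * t) = u * (1 - t)" by (simp add: algebra_simps)
    thus "?c * (pos_power z (1 - t) * pos_power a t) =
        pos_power z (u - (0 + u * t)) * pos_power a (0 + u * t)"
      using assms(3) by (simp only: pos_power_mult add_0_left) (simp add: mult_ac)
  qed
  also have "?c * ?B = (pos_power (z + a) u * ?B) /\<^sub>R \<bar>u\<bar>"
  proof -
    have "complex_of_real u powr (z + a - 1) = ?c * complex_of_real u"
      using assms(3) by (simp add: powr_add powr_diff field_simps)
    thus ?thesis using assms(3)
      by (simp add: pos_power_def scaleR_conv_of_real field_simps)
  qed
  finally show ?thesis
    using assms(3) lborel_has_bochner_integral_real_affine_iff
      [of u "\<lambda>t. pos_power z (u - t) * pos_power a t" "pos_power (z + a) u * ?B" 0] by simp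
qed

text \<open>
  Both sides of \<open>\<Gamma>(a) \<Gamma>(z) = B \<Gamma>(z + a)\<close> are the double integral of
  \<open>gamma_density a t * gamma_density z (u - t)\<close>. Integrating over \<open>u\<close> first gives the left side,
  integrating over \<open>t\<close> first gives the right side, since there the exponential factors combine to
  \<open>e\<^sup>-\<^sup>u\<close>.
\<close>

lemma integral_pos_power_conv:
  assumes "Re z > 0" "Re a > 0"
  shows "(LBINT t. pos_power z (1 - t) * pos_power a t) = Beta z a"
proof -
  let ?B = "LBINT t. pos_power z (1 - t) * pos_power a t"
  define H where "H = (\<lambda>(t, u). gamma_density a t * gamma_density z (u - t))"
  have [measurable]: "H \<in> borel_measurable (lborel \<Otimes>\<^sub>M lborel)"
    unfolding H_def by measurable
  note dens = has_bochner_integral_gamma_density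
  have shift: "has_bochner_integral lborel (\<lambda>u. f (u - t)) I"
    if "has_bochner_integral lborel f I" for f :: "real \<Rightarrow> 'b::{banach, second_countable_topology}" and I t
    using that lborel_has_bochner_integral_real_affine_iff[of 1 f I "- t"] by (simp add: add.commute)
  have slice: "has_bochner_integral lborel (\<lambda>u. H (t, u)) (gamma_density a t * Gamma z)" for t
    unfolding H_def prod.case
    by (intro has_bochner_integral_mult_right shift dens assms)
  define M where "M = (LBINT u. norm (gamma_density z u))"
  have "has_bochner_integral lborel (\<lambda>u. norm (gamma_density z u)) M"
    unfolding M_def has_bochner_integral_iff
    using dens[OF assms(1)] by (auto simp: has_bochner_integral_iff)
  hence "has_bochner_integral lborel (\<lambda>u. norm (gamma_density a t) * norm (gamma_density z (u - t)))
      (norm (gamma_density a t) * M)" for t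
    by (intro has_bochner_integral_mult_right shift)
  hence norm_slice: "(LBINT u. norm (H (t, u))) = norm (gamma_density a t) * M" for t
    unfolding H_def by (simp add: norm_mult has_bochner_integral_iff)
  have H: "integrable (lborel \<Otimes>\<^sub>M lborel) H"
  proof (rule lborel_pair.Fubini_integrable)
    show "integrable lborel (\<lambda>t. LBINT u. norm (H (t, u)))"
      unfolding norm_slice using dens[OF assms(2)] by (auto simp: has_bochner_integral_iff)
    show "AE t in lborel. integrable lborel (\<lambda>u. H (t, u))"
      using slice by (auto simp: has_bochner_integral_iff)
  qed measurable
  have inner: "(LBINT t. H (t, u)) = gamma_density (z + a) u * ?B" for u
  proof (cases "u > 0")
    case True
    have "H (t, u) = complex_of_real (exp (- u)) * (pos_power z (u - t) * pos_power a t)" for t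
    proof -
      have "exp (- u) = exp (- t) * exp (- (u - t))" by (simp flip: exp_add)
      thus ?thesis unfolding H_def gamma_density_def prod.case by (simp only: of_real_mult mult_ac)
    qed
    thus ?thesis
      using has_bochner_integral_pos_power_conv_scaled[OF assms True]
      by (simp add: has_bochner_integral_iff gamma_density_def)
  next
    case False
    \<comment> \<open>The two supports are disjoint.\<close>
    hence "H (t, u) = 0" for t
      by (auto simp: H_def gamma_density_def pos_power_def)
    thus ?thesis using False by (simp add: gamma_density_def pos_power_def)
  qed
  have "Gamma a * Gamma z = (LBINT t. LBINT u. H (t, u))"
    using slice dens[OF assms(2)] by (simp add: has_bochner_integral_iff)
  also have "\<dots> = (LBINT u. LBINT t. H (t, u))"
    using lborel_pair.Fubini_integral[of "\<lambda>t u. H (t, u)"] H by simp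
  also have "\<dots> = Gamma (z + a) * ?B"
    unfolding inner using dens[of "z + a"] assms by (simp add: has_bochner_integral_iff)
  finally have "Gamma a * Gamma z = Gamma (z + a) * ?B" .
  moreover have "Gamma (z + a) \<noteq> 0"
    using assms by (intro Gamma_nonzero_of_Re_pos) simp
  ultimately show ?thesis
    by (simp add: Beta_def field_simps)
qed

section \<open>Fractional calculus of normalised powers\<close>

text \<open>
  The reciprocal Gamma function is entire and vanishes exactly where \<open>\<Gamma>\<close> has its poles, so that the
  rule for the derivative below holds for every exponent.
\<close>

definition normalised_power :: "real \<Rightarrow> complex \<Rightarrow> real \<Rightarrow> complex" where
  "normalised_power b a x = rGamma (a + 1) * complex_of_real (x - b) powr a"

text \<open>
  In \<open>B(\<kappa>, a + 1) = \<Gamma>(\<kappa>) \<Gamma>(a + 1) / \<Gamma>(a + \<kappa> + 1)\<close> the factor \<open>\<Gamma>(a + 1)\<close> cancels the old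
  normalisation and the denominator supplies the new one; \<open>\<Gamma>(\<kappa>)\<close> is the factor that the fractional
  integral divides by. The restriction to \<open>{b..x}\<close> is absorbed by the cut-offs, including the end
  points, where both integrands vanish because \<open>0 powr z = 0\<close>.
\<close>

lemma has_bochner_integral_conv_normalised_power:
  assumes "Re \<kappa> > 0" "Re a > -1" "x > b"
  shows "has_bochner_integral lborel
           (\<lambda>\<xi>. indicator {b..x} \<xi> *\<^sub>R rl_integrand \<kappa> (normalised_power b a) x \<xi>)
           (Gamma \<kappa> * normalised_power b (a + \<kappa>) x)"
proof -
  let ?f = "\<lambda>t. pos_power \<kappa> ((x - b) - t) * pos_power (a + 1) t"
  have "has_bochner_integral lborel ?f (pos_power (\<kappa> + (a + 1)) (x - b) * Beta \<kappa> (a + 1))"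
    using has_bochner_integral_pos_power_conv_scaled[of \<kappa> "a + 1" "x - b"]
      integral_pos_power_conv[of \<kappa> "a + 1"] assms by simp
  hence "has_bochner_integral lborel (\<lambda>\<xi>. ?f (- b + 1 * \<xi>))
      (pos_power (\<kappa> + (a + 1)) (x - b) * Beta \<kappa> (a + 1))"
    using lborel_has_bochner_integral_real_affine_iff[of 1 ?f _ "- b"] by simp
  hence "has_bochner_integral lborel (\<lambda>\<xi>. rGamma (a + 1) * ?f (- b + 1 * \<xi>))
      (rGamma (a + 1) * (pos_power (\<kappa> + (a + 1)) (x - b) * Beta \<kappa> (a + 1)))"
    by (intro has_bochner_integral_mult_right) auto
  also have "(\<lambda>\<xi>. rGamma (a + 1) * ?f (- b + 1 * \<xi>)) =
      (\<lambda>\<xi>. indicator {b..x} \<xi> *\<^sub>R rl_integrand \<kappa> (normalised_power b a) x \<xi>)"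
    by (auto simp: fun_eq_iff pos_power_def rl_integrand_def normalised_power_def indicator_def
             simp del: of_real_diff)
  also have "rGamma (a + 1) * (pos_power (\<kappa> + (a + 1)) (x - b) * Beta \<kappa> (a + 1)) =
      Gamma \<kappa> * normalised_power b (a + \<kappa>) x"
  proof -
    have "Gamma (a + 1) \<noteq> 0"
      using assms by (intro Gamma_nonzero_of_Re_pos) simp
    hence "rGamma (a + 1) * Gamma (a + 1) = 1"
      by (simp add: rGamma_inverse_Gamma)
    thus ?thesis using assms(3)
      by (simp add: Beta_altdef pos_power_def normalised_power_def add_ac mult_ac)
  qed
  finally show ?thesis .
qed

lemma has_vector_derivative_normalised_power:
  assumes "x > b"
  shows "(normalised_power b a has_vector_derivative normalised_power b (a - 1) x) (at x)"
proof -
  have "((\<lambda>z. rGamma (a + 1) * (z - complex_of_real b) powr a) has_field_derivative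
      rGamma (a + 1) * (a * (complex_of_real x - complex_of_real b) powr (a - 1)))
      (at (complex_of_real x))"
    using assms
    by (auto intro!: derivative_eq_intros simp flip: of_real_diff)
  from has_vector_derivative_real_field[OF this] rGamma_plus1[of a]
  show ?thesis
    by (simp add: normalised_power_def [abs_def] mult_ac) (metis mult.assoc mult.commute)
qed

text \<open>
  A fractional integral is known in closed form only on \<open>{b<..}\<close>, which suffices for derivatives of
  all orders because each of them is local.
\<close>

lemma nth_vderiv_eq_on_open:
  assumes "open S"
    and "\<And>x. x \<in> S \<Longrightarrow> g x = G 0 x"
    and "\<And>k x. x \<in> S \<Longrightarrow> (G k has_vector_derivative G (Suc k) x) (at x)"
  shows "x \<in> S \<Longrightarrow> nth_vderiv k g x = G k x"
    and "x \<in> S \<Longrightarrow> nth_vderiv k g differentiable (at x)"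
proof -
  have deriv: "(nth_vderiv k g has_vector_derivative G (Suc k) x) (at x)"
    if "\<forall>y\<in>S. nth_vderiv k g y = G k y" "x \<in> S" for k x
    using has_vector_derivative_transform_within_open[OF assms(3) assms(1)] that by simp
  have eq: "\<forall>y\<in>S. nth_vderiv k g y = G k y" for k
  proof (induction k)
    case 0
    thus ?case using assms(2) by (simp add: nth_vderiv_def)
  next
    case (Suc k)
    thus ?case using deriv[OF Suc]
      by (auto simp: nth_vderiv_def intro!: vector_derivative_at)
  qed
  show "x \<in> S \<Longrightarrow> nth_vderiv k g x = G k x"
    using eq by blast
  show "x \<in> S \<Longrightarrow> nth_vderiv k g differentiable (at x)"
    using deriv[OF eq] by (auto simp: differentiable_def has_vector_derivative_def)
qed

lemma rl_integral_sum_normalised_power: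
  assumes f: "\<And>\<xi>. \<xi> \<ge> b \<Longrightarrow> f \<xi> = (\<Sum>i\<in>I. c i * normalised_power b (a i) \<xi>)"
    and "\<And>i. i \<in> I \<Longrightarrow> Re (a i) > -1"
    and "Re \<kappa> > 0" "x > b"
  shows "rl_integrand \<kappa> f x absolutely_integrable_on {b..x}"
    and "rl_integral \<kappa> b f x = (\<Sum>i\<in>I. c i * normalised_power b (a i + \<kappa>) x)"
proof -
  let ?S = "\<Sum>i\<in>I. c i * normalised_power b (a i + \<kappa>) x"
  let ?g = "\<lambda>\<xi>. indicator {b..x} \<xi> *\<^sub>R rl_integrand \<kappa> f x \<xi>"
  have "has_bochner_integral lborel
      (\<lambda>\<xi>. \<Sum>i\<in>I. c i * (indicator {b..x} \<xi> *\<^sub>R rl_integrand \<kappa> (normalised_power b (a i)) x \<xi>))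
      (\<Sum>i\<in>I. c i * (Gamma \<kappa> * normalised_power b (a i + \<kappa>) x))"
    using assms(2-)
    by (intro has_bochner_integral_sum has_bochner_integral_mult_right
        has_bochner_integral_conv_normalised_power) auto
  also have "(\<lambda>\<xi>. \<Sum>i\<in>I. c i * (indicator {b..x} \<xi> *\<^sub>R rl_integrand \<kappa> (normalised_power b (a i)) x \<xi>)) = ?g"
    by (auto simp: fun_eq_iff rl_integrand_def indicator_def f sum_distrib_left mult_ac)
  also have "(\<Sum>i\<in>I. c i * (Gamma \<kappa> * normalised_power b (a i + \<kappa>) x)) = Gamma \<kappa> * ?S"
    by (simp add: sum_distrib_left mult_ac)
  finally have hbi: "has_bochner_integral lborel ?g (Gamma \<kappa> * ?S)" .
  hence set_int: "set_integrable lborel {b..x} (rl_integrand \<kappa> f x)"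
    by (simp add: set_integrable_def has_bochner_integral_iff)
  show "rl_integrand \<kappa> f x absolutely_integrable_on {b..x}"
    using set_int unfolding set_integrable_def
    by (subst integrable_completion) (auto dest: borel_measurable_integrable)
  have "integral {b..x} (rl_integrand \<kappa> f x) = Gamma \<kappa> * ?S"
    using set_borel_integral_eq_integral(2)[OF set_int] hbi
    by (simp add: set_lebesgue_integral_def has_bochner_integral_iff)
  moreover have "Gamma \<kappa> \<noteq> 0"
    using assms by (intro Gamma_nonzero_of_Re_pos) simp
  ultimately show "rl_integral \<kappa> b f x = ?S"
    by (simp add: rl_integral_def)
qed

lemma rl_deriv_sum_normalised_power:
  assumes f: "\<And>\<xi>. \<xi> \<ge> b \<Longrightarrow> f \<xi> = (\<Sum>i\<in>I. c i * normalised_power b (a i) \<xi>)"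
    and a: "\<And>i. i \<in> I \<Longrightarrow> Re (a i) > -1"
    and "Re \<tau> \<ge> 0"
  shows "rl_deriv_exists \<tau> b f"
    and "x > b \<Longrightarrow> rl_deriv \<tau> b f x = (\<Sum>i\<in>I. c i * normalised_power b (a i - \<tau>) x)"
proof -
  define n where "n = rl_order \<tau>"
  define \<kappa> where "\<kappa> = of_nat n - \<tau>"
  have "Re \<kappa> > 0"
    using assms(3) by (simp add: \<kappa>_def n_def rl_order_def) linarith
  note int = rl_integral_sum_normalised_power[OF f a this]
  define G where "G = (\<lambda>k x. \<Sum>i\<in>I. c i * normalised_power b (a i + \<kappa> - of_nat k) x)"
  have "(G k has_vector_derivative G (Suc k) x) (at x)" if "x > b" for k x
    unfolding G_def
  proof (intro has_vector_derivative_sum has_vector_derivative_mult_right)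
    fix i
    show "(normalised_power b (a i + \<kappa> - of_nat k) has_vector_derivative
        normalised_power b (a i + \<kappa> - of_nat (Suc k)) x) (at x)"
      using has_vector_derivative_normalised_power[OF that, of "a i + \<kappa> - of_nat k"]
      by (simp add: algebra_simps)
  qed
  hence nth: "nth_vderiv k (rl_integral \<kappa> b f) x = G k x"
    "nth_vderiv k (rl_integral \<kappa> b f) differentiable (at x)" if "x > b" for k x
    using nth_vderiv_eq_on_open[of "{b<..}" "rl_integral \<kappa> b f" G x k] that int(2)
    by (auto simp: G_def)
  show "rl_deriv_exists \<tau> b f"
    unfolding rl_deriv_exists_def using int(1) nth(2) by (simp add: \<kappa>_def n_def)
  show "rl_deriv \<tau> b f x = (\<Sum>i\<in>I. c i * normalised_power b (a i - \<tau>) x)" if "x > b"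
    using nth(1)[OF that, of n] by (simp add: rl_deriv_def G_def \<kappa>_def n_def)
qed

section \<open>The weighted polynomials\<close>

definition KN_weighted_coeff :: "nat \<Rightarrow> nat \<Rightarrow> real \<Rightarrow> real \<Rightarrow> real \<Rightarrow> nat \<times> nat \<Rightarrow> complex" where
  "KN_weighted_coeff s \<upsilon> p t y = (\<lambda>(k, m).
     complex_of_real (Gamma (p - real s)) * pochhammer (- of_nat s) (k + m) *
     complex_of_real (t ^ (s - k) * y ^ (\<upsilon> * m)) /
     (complex_of_real (Gamma (p - 2 * real s + real k)) * fact k * fact m))"

text \<open>
  Since \<open>Q\<close> enters through the exponents alone, the two sides of the theorem are instances of this
  expansion, at \<open>Q = q\<close> and at \<open>Q = q - \<tau>\<close>, with the same coefficients.
\<close>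

lemma powr_mult_KN_eq_sum_normalised_power:
  assumes "x \<ge> b"
  shows "complex_of_real (x - b) powr Q * KN s \<upsilon> p Q t (y * (x - b)) =
    (\<Sum>i\<in>(SIGMA k:{0..s}. {0..s - k}).
       KN_weighted_coeff s \<upsilon> p t y i * normalised_power b (Q + of_nat (\<upsilon> * snd i)) x)"
proof (cases "x = b")
  case True
  thus ?thesis by (simp add: normalised_power_def)
next
  case False
  define r where "r = complex_of_real (x - b)"
  have r: "r \<noteq> 0" using False by (simp add: r_def)
  have term_eq: "r powr Q * (complex_of_real (Gamma (p - real s)) *
        (pochhammer (- of_nat s) (k + m) * complex_of_real (t ^ (s - k) * (y * (x - b)) ^ (\<upsilon> * m)) /
        (complex_of_real (Gamma (p - 2 * real s + real k)) *
         Gamma (Q + 1 + of_nat (\<upsilon> * m)) * fact k * fact m))) =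
      KN_weighted_coeff s \<upsilon> p t y (k, m) * normalised_power b (Q + of_nat (\<upsilon> * m)) x" for k m
  proof -
    have "r powr (Q + of_nat (\<upsilon> * m)) = r powr Q * r ^ (\<upsilon> * m)"
      using r by (simp add: powr_add powr_nat' del: of_nat_mult)
    moreover have "complex_of_real ((y * (x - b)) ^ (\<upsilon> * m)) =
        complex_of_real (y ^ (\<upsilon> * m)) * r ^ (\<upsilon> * m)"
      by (simp add: r_def power_mult_distrib)
    moreover have "Q + of_nat (\<upsilon> * m) + 1 = Q + 1 + of_nat (\<upsilon> * m)"
      by simp
    ultimately show ?thesis
      unfolding KN_weighted_coeff_def normalised_power_def prod.case r_def[symmetric]
      by (simp only: rGamma_inverse_Gamma divide_inverse of_real_mult inverse_mult_distrib mult_ac)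
  qed
  have "r powr Q * KN s \<upsilon> p Q t (y * (x - b)) = (\<Sum>k = 0..s. \<Sum>m = 0..s - k.
      KN_weighted_coeff s \<upsilon> p t y (k, m) * normalised_power b (Q + of_nat (\<upsilon> * m)) x)"
    unfolding KN_def sum_distrib_left by (intro sum.cong refl term_eq)
  also have "\<dots> = (\<Sum>i\<in>(SIGMA k:{0..s}. {0..s - k}).
      KN_weighted_coeff s \<upsilon> p t y i * normalised_power b (Q + of_nat (\<upsilon> * snd i)) x)"
    by (subst sum.Sigma) (auto intro!: sum.cong)
  finally show ?thesis
    by (simp only: r_def)
qed

theorem theorem33:
  fixes \<upsilon> s :: nat and p q b t y w :: real and \<tau> :: complex
  assumes "\<upsilon> \<ge> 1"
    and "q > -1"
    and "real s < (p - 1) / 2"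
    and "w > b"
    and "Re \<tau> \<ge> 0"
    and "q + 1 > Re \<tau>"
  defines "f \<equiv> (\<lambda>x. complex_of_real ((x - b) powr q) *
                     KN s \<upsilon> p (complex_of_real q) t (y * (x - b)))"
  shows "rl_deriv_exists \<tau> b f \<and>
         rl_deriv \<tau> b f w =
           complex_of_real (w - b) powr (complex_of_real q - \<tau>) *
           KN s \<upsilon> p (complex_of_real q - \<tau>) t (y * (w - b))"
proof -
  let ?I = "SIGMA k:{0..s}. {0..s - k}"
  let ?c = "KN_weighted_coeff s \<upsilon> p t y"
  let ?a = "\<lambda>i :: nat \<times> nat. complex_of_real q + of_nat (\<upsilon> * snd i)"
  have f: "f \<xi> = (\<Sum>i\<in>?I. ?c i * normalised_power b (?a i) \<xi>)" if "\<xi> \<ge> b" for \<xi>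
    using powr_mult_KN_eq_sum_normalised_power[OF that, where Q = "complex_of_real q"] that
    by (simp add: f_def powr_of_real flip: of_real_diff)
  have a: "Re (?a i) > -1" for i
    using \<open>q > -1\<close> by (simp add: add_strict_increasing2 less_le_trans)
  note deriv = rl_deriv_sum_normalised_power[where f = f and I = ?I and c = ?c and a = ?a, OF f a \<open>Re \<tau> \<ge> 0\<close>]
  have "rl_deriv \<tau> b f w = (\<Sum>i\<in>?I. ?c i * normalised_power b (?a i - \<tau>) w)"
    using deriv(2) \<open>w > b\<close> by blast
  also have "\<dots> = complex_of_real (w - b) powr (complex_of_real q - \<tau>) *
      KN s \<upsilon> p (complex_of_real q - \<tau>) t (y * (w - b))"
    using \<open>w > b\<close> by (subst powr_mult_KN_eq_sum_normalised_power) (simp_all add: algebra_simps)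
  finally show ?thesis
    using deriv(1) by blast
qed

end
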